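(* Let $\{a_1,a_2\}^*$ be the free monoid on two letters and let $\mu:\{a_1,a_2\}^*\to(\mathbb{Z}_{\min})^{6\times 6}$ be the unique monoid morphism (for the min-plus matrix product) with $\mu(a_1)=\mathrm{diag}(N_1,D)$ and $\mu(a_2)=\mathrm{diag}(N_2,D)$, where $$N_1=\begin{pmatrix}0&\infty&\infty&\infty\\ \infty&1&1&\infty\\ \infty&\infty&\infty&\infty\\ \infty&\infty&\infty&0\end{pmatrix},\quad N_2=\begin{pmatrix}1&1&\infty&\infty\\ \infty&\infty&\infty&0\\ \infty&\infty&\infty&0\\ \infty&\infty&\infty&0\end{pmatrix},\quad D=\begin{pmatrix}-1&\infty\\ \infty&0\end{pmatrix},$$ and $\mathrm{diag}(F,G)$ is the block matrix with diagonal blocks $F$, $G$ and all other entries $\infty$. Let $B=(0,\infty,\infty,0,0,0)^T$. Then the reachable space $\mathcal{R}=\mathrm{span}\{\mu(w)B\mid w\in\{a_1,a_2\}^*\}$ is not a rational subsemimodule of $(\mathbb{Z}_{\min})^6$. Moreover, the semigroup $\mu(\{a_1,a_2\}^* )$ is not a rational subset of the monoid $((\mathbb{Z}\cup\{+\infty\})^{6\times 6},+)$.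
   Context: $\mathbb{Z}_{\min}$ is the semiring with set $\mathbb{Z}\cup\{+\infty\}$, addition $\oplus=\min$, multiplication $\otimes=+$; its zero is $\infty=+\infty$ and its unit is $0$. Matrix products are min-plus: $(FG)_{ij}=\min_k(F_{ik}+G_{kj})$. The free semimodule $(\mathbb{Z}_{\min})^n$ has entrywise min as addition and action $(\lambda x)_i=\lambda+x_i$. For $G\subset(\mathbb{Z}_{\min})^n$, $\mathrm{span}\,G$ is the set of finite linear combinations $\bigoplus_{i=1}^k\lambda_iu^i$ with $u^i\in G$, $\lambda_i\in\mathbb{Z}_{\min}$. The class of rational subsets of a monoid $(M,\cdot)$ with unit $1_M$ is the least class of subsets of $M$ that contains all finite subsets and is closed under union, product $U\cdot V=\{u\cdot v\mid u\in U,v\in V\}$, and star $U^*=U^0\cup U\cup U^2\cup\cdots$, where $U^0=\{1_M\}$. A subsemimodule $\mathcal{X}\subset(\mathbb{Z}_{\min})^n$ is rational if $\mathcal{X}=\mathrm{span}\,G$ for some rational subset $G$ of the monoid $((\mathbb{Z}\cup\{+\infty\})^n,+)$ with entrywise addition. The monoid $((\mathbb{Z}\cup\{+\infty\})^{6\times 6},+)$ is likewise the set of $6\times 6$ matrices with entrywise usual addition. *)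

theory Defs
  imports "HOL-Analysis.Analysis" "HOL-Library.Set_Algebras"
begin

section \<open>The min-plus semiring of integers\<close>

datatype zmin = Fin int | Infty

text \<open>
  The class operations on \<^typ>\<open>zmin\<close> are the semiring ones: \<open>x + y\<close> is the minimum and
  \<open>x * y\<close> is the usual addition. Consequently \<open>0 :: zmin\<close> is \<^term>\<open>Infty\<close> and
  \<open>1 :: zmin\<close> is \<^term>\<open>Fin 0\<close>; entries are therefore never written as numerals below.
\<close>

instantiation zmin :: comm_semiring_1
begin

definition zero_zmin :: zmin where
  "0 = Infty"

definition one_zmin :: zmin where
  "1 = Fin 0"

fun plus_zmin :: "zmin \<Rightarrow> zmin \<Rightarrow> zmin" where
  "Fin a + Fin b = Fin (min a b)"
| "Infty + y = y"
| "x + Infty = x"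

fun times_zmin :: "zmin \<Rightarrow> zmin \<Rightarrow> zmin" where
  "Fin a * Fin b = Fin (a + b)"
| "Infty * y = Infty"
| "x * Infty = Infty"

instance
proof
  fix a b c :: zmin
  show "a * b * c = a * (b * c)"
    by (cases a; cases b; cases c) auto
  show "a * b = b * a"
    by (cases a; cases b) auto
  show "1 * a = a"
    by (cases a) (auto simp: one_zmin_def)
  show "a + b + c = a + (b + c)"
    by (cases a; cases b; cases c) auto
  show "a + b = b + a"
    by (cases a; cases b) auto
  show "0 + a = a"
    by (cases a) (auto simp: zero_zmin_def)
  show "(a + b) * c = a * c + b * c"
    by (cases a; cases b; cases c) auto
  show "0 * a = 0"
    by (cases a) (auto simp: zero_zmin_def)
  show "a * 0 = 0"
    by (cases a) (auto simp: zero_zmin_def)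
  show "(0 :: zmin) \<noteq> 1"
    by (simp add: zero_zmin_def one_zmin_def)
qed

end

text \<open>
  With this instance, \<open>**\<close>, \<open>*v\<close> and \<^term>\<open>mat 1\<close> are the min-plus products and identity
  matrix, \<open>*s\<close> is the semimodule action, and \<open>+\<close> on vectors is the entrywise minimum.
  The componentwise product \<open>*\<close> on \<^typ>\<open>zmin^'n\<close> and on \<^typ>\<open>zmin^'n^'m\<close> is
  entrywise usual addition, so the class \<^class>\<open>monoid_mult\<close> provides exactly the monoids
  of vectors and of matrices under entrywise usual addition (with all entries of the unit
  equal to \<^term>\<open>Fin 0\<close>).
\<close>

section \<open>Rational sets and rational semimodules\<close>

text \<open>Products and powers of sets are those of \<^theory>\<open>HOL-Library.Set_Algebras\<close>; in particular
  \<open>U ^ 0 = {1}\<close>.\<close>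

inductive rational :: "'a::monoid_mult set \<Rightarrow> bool" where
  rational_finite: "finite U \<Longrightarrow> rational U"
| rational_union: "rational U \<Longrightarrow> rational V \<Longrightarrow> rational (U \<union> V)"
| rational_product: "rational U \<Longrightarrow> rational V \<Longrightarrow> rational (U * V)"
| rational_star: "rational U \<Longrightarrow> rational (\<Union>k. U ^ k)"

definition semimodule_span :: "(zmin^'n) set \<Rightarrow> (zmin^'n) set" where
  "semimodule_span G =
    {(\<Sum>i<k. l i *s u i) | (k :: nat) (l :: nat \<Rightarrow> zmin) (u :: nat \<Rightarrow> zmin^'n). \<forall>i<k. u i \<in> G}"

text \<open>Every span is a subsemimodule, so this need not be required separately.\<close>

definition rational_subsemimodule :: "(zmin^'n) set \<Rightarrow> bool" where
  "rational_subsemimodule X \<longleftrightarrow> (\<exists>G. rational G \<and> X = semimodule_span G)"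

section \<open>The matrix representation\<close>

definition N\<^sub>1 :: "zmin^4^4" where
  "N\<^sub>1 = vector
    [vector [Fin 0, Infty, Infty, Infty],
     vector [Infty, Fin 1, Fin 1, Infty],
     vector [Infty, Infty, Infty, Infty],
     vector [Infty, Infty, Infty, Fin 0]]"

definition N\<^sub>2 :: "zmin^4^4" where
  "N\<^sub>2 = vector
    [vector [Fin 1, Fin 1, Infty, Infty],
     vector [Infty, Infty, Infty, Fin 0],
     vector [Infty, Infty, Infty, Fin 0],
     vector [Infty, Infty, Infty, Fin 0]]"

definition D :: "zmin^2^2" where
  "D = vector
    [vector [Fin (-1), Infty],
     vector [Infty, Fin 0]]"

definition diag :: "zmin^4^4 \<Rightarrow> zmin^2^2 \<Rightarrow> zmin^6^6" where
  "diag F G = vector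
    [vector [F$1$1, F$1$2, F$1$3, F$1$4, Infty, Infty],
     vector [F$2$1, F$2$2, F$2$3, F$2$4, Infty, Infty],
     vector [F$3$1, F$3$2, F$3$3, F$3$4, Infty, Infty],
     vector [F$4$1, F$4$2, F$4$3, F$4$4, Infty, Infty],
     vector [Infty, Infty, Infty, Infty, G$1$1, G$1$2],
     vector [Infty, Infty, Infty, Infty, G$2$1, G$2$2]]"

definition B :: "zmin^6" where
  "B = vector [Fin 0, Infty, Infty, Fin 0, Fin 0, Fin 0]"

datatype letter = a\<^sub>1 | a\<^sub>2

fun letter_matrix :: "letter \<Rightarrow> zmin^6^6" where
  "letter_matrix a\<^sub>1 = diag N\<^sub>1 D"
| "letter_matrix a\<^sub>2 = diag N\<^sub>2 D"

text \<open>The free monoid on two letters is \<^typ>\<open>letter list\<close> under concatenation.\<close>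

primrec \<mu> :: "letter list \<Rightarrow> zmin^6^6" where
  "\<mu> [] = mat 1"
| "\<mu> (a # w) = letter_matrix a ** \<mu> w"

lemma \<mu>_append: "\<mu> (v @ w) = \<mu> v ** \<mu> w"
  by (induction v) (simp_all add: matrix_mul_assoc)

lemma \<mu>_unique:
  "f = \<mu> \<longleftrightarrow>
    f [] = mat 1 \<and> (\<forall>v w. f (v @ w) = f v ** f w) \<and>
    f [a\<^sub>1] = diag N\<^sub>1 D \<and> f [a\<^sub>2] = diag N\<^sub>2 D"
proof (intro iffI ext)
  fix w
  assume *: "f [] = mat 1 \<and> (\<forall>v w. f (v @ w) = f v ** f w) \<and>
    f [a\<^sub>1] = diag N\<^sub>1 D \<and> f [a\<^sub>2] = diag N\<^sub>2 D"
  show "f w = \<mu> w"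
  proof (induction w)
    case (Cons a w)
    have "f (a # w) = f [a] ** f w"
      using * by (metis append_Cons append_Nil)
    moreover have "f [a] = letter_matrix a"
      using * by (cases a) auto
    ultimately show ?case
      using Cons by simp
  qed (use * in simp)
qed (simp add: \<mu>_append)

definition reachable_space :: "(zmin^6) set" where
  "reachable_space = semimodule_span {\<mu> w *v B | w. True}"

end

theory Submission
  imports Defs
begin

text \<open>
  A rational subset of a commutative monoid is a finite union of translates of submonoids. Let a
  translate lie in a region \<open>min(p, p')\<^sup>2 \<le> 2q\<close>, \<open>p, p' \<ge> 0\<close> with \<open>p\<close>, \<open>p'\<close>, \<open>q\<close> additive. Then \<open>p\<close> or
  \<open>p'\<close> vanishes on the submonoid, since powers of an element with \<open>p, p' > 0\<close> leave the region;
  hence \<open>min(p, p')\<close> is bounded on every rational subset of the region.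

  The first coordinate of \<open>\<mu> w *v B\<close> can be raised from \<open>n\<close> to \<open>n + 1\<close> only after a block of at
  least \<open>n\<close> letters \<open>a\<^sub>1\<close>, so the value \<open>n\<close> requires at least \<open>n(n + 1)/2\<close> letters, and the block \<open>D\<close>
  records the length. This first coordinate is the minimum of the entries (1,1) and (1,4) of
  \<open>\<mu> w\<close>, and it is unbounded. The differences of coordinates \<open>g\<^sub>1 - g\<^sub>4\<close> and \<open>g\<^sub>4 - g\<^sub>5\<close> are
  invariant under scaling, and the inequality between them survives linear combinations, so
  it passes to every generating set of the reachable space.
\<close>

section \<open>Rational subsets of commutative monoids\<close>

definition submonoid :: "'a::monoid_mult set \<Rightarrow> bool" where
  "submonoid M \<longleftrightarrow> 1 \<in> M \<and> (\<forall>x\<in>M. \<forall>y\<in>M. x * y \<in> M)"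

text \<open>A weak form of semilinearity: the submonoids may be arbitrary, so no generators are
  tracked.\<close>

inductive coset_union :: "'a::comm_monoid_mult set \<Rightarrow> bool" where
  empty: "coset_union {}"
| coset: "submonoid M \<Longrightarrow> coset_union ({a} * M)"
| union: "coset_union U \<Longrightarrow> coset_union V \<Longrightarrow> coset_union (U \<union> V)"

lemma submonoid_power: "submonoid M \<Longrightarrow> x \<in> M \<Longrightarrow> x ^ k \<in> M"
  by (induction k) (auto simp: submonoid_def)

lemma submonoid_times:
  fixes M N :: "'a::comm_monoid_mult set"
  assumes "submonoid M" "submonoid N"
  shows "submonoid (M * N)"
  unfolding submonoid_def
proof (intro conjI ballI)
  show "1 \<in> M * N"
    using assms set_times_intro[of 1 M 1 N] by (auto simp: submonoid_def)
next
  fix x y assume "x \<in> M * N" "y \<in> M * N"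
  then obtain m n m' n' where *: "x = m * n" "y = m' * n'" "m \<in> M" "n \<in> N" "m' \<in> M" "n' \<in> N"
    by (auto elim!: set_times_elim)
  have "x * y = (m * m') * (n * n')"
    using * by (simp add: ac_simps)
  then show "x * y \<in> M * N"
    using * assms by (auto simp: submonoid_def intro!: set_times_intro)
qed

lemma submonoid_powers: "submonoid (range ((^) (a::'a::monoid_mult)))"
  unfolding submonoid_def
  by (auto simp flip: power_add intro: rangeI range_eqI[where x = 0])

lemma set_times_empty [simp]:
  fixes W :: "'a::times set"
  shows "{} * W = {}" "W * {} = {}"
  by (simp_all add: set_times_def)

lemma set_times_singleton [simp]: "{a} * {b} = {a * b}"
  by (simp add: set_times_def)

lemma coset_union_times_coset:
  assumes "coset_union U" "submonoid M"
  shows "coset_union (U * ({a} * M))"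
  using assms(1)
proof induction
  case (coset N b)
  have "{b} * N * ({a} * M) = {b * a} * (N * M)"
    by (simp only: ac_simps flip: set_times_singleton)
  then show ?case
    using coset_union.coset[OF submonoid_times[OF coset assms(2)]] by simp
qed (auto simp: set_times_Un_distrib intro: coset_union.intros)

lemma coset_union_times:
  assumes "coset_union U" "coset_union V"
  shows "coset_union (U * V)"
  using assms(2,1)
  by induction (auto simp: set_times_Un_distrib intro: coset_union.intros coset_union_times_coset)

lemma coset_union_singleton: "coset_union {a}"
proof -
  have "submonoid {1 :: 'a}"
    by (auto simp: submonoid_def)
  from coset_union.coset[OF this, of a] show ?thesis
    by simp
qed

lemma coset_union_finite: "finite U \<Longrightarrow> coset_union U"
proof (induction rule: finite_induct)
  case (insert a U)
  then show ?case
    using coset_union.union[OF coset_union_singleton, of U a] by simp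
qed (rule coset_union.empty)

text \<open>By commutativity the factors from \<open>U\<close> can be collected before those from
  \<open>V\<close>. This reduces the star of a union to a product of stars.\<close>

lemma set_power_Un:
  fixes U V :: "'a::comm_monoid_mult set"
  shows "(\<Union>k. (U \<union> V) ^ k) = (\<Union>k. U ^ k) * (\<Union>k. V ^ k)"
proof (intro set_eqI iffI)
  fix x assume "x \<in> (\<Union>k. (U \<union> V) ^ k)"
  then obtain k where "x \<in> (U \<union> V) ^ k" by auto
  then have "\<exists>i j. x \<in> U ^ i * V ^ j"
  proof (induction k arbitrary: x)
    case 0
    then have "x \<in> U ^ 0 * V ^ 0" by (simp only: power_0 mult_1)
    then show ?case by blast
  next
    case (Suc k)
    then obtain y z where yz: "x = y * z" "y \<in> U \<union> V" "z \<in> (U \<union> V) ^ k"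
      by (auto elim: set_times_elim)
    with Suc.IH obtain i j where "z \<in> U ^ i * V ^ j" by blast
    then have "x \<in> (U ^ Suc i * V ^ j) \<union> (U ^ i * V ^ Suc j)"
      using yz(1,2) by (auto simp: mult.assoc mult.left_commute[of "U ^ i"] intro: set_times_intro)
    then show ?case by blast
  qed
  then show "x \<in> (\<Union>k. U ^ k) * (\<Union>k. V ^ k)"
    by (auto elim!: set_times_elim intro!: set_times_intro)
next
  have mono: "A ^ k \<subseteq> B ^ k" if "A \<subseteq> B" for A B :: "'a set" and k
    using that by (induction k) (simp_all add: set_times_mono2)
  fix x assume "x \<in> (\<Union>k. U ^ k) * (\<Union>k. V ^ k)"
  then obtain i j where "x \<in> U ^ i * V ^ j"
    by (auto elim!: set_times_elim intro!: set_times_intro)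
  moreover have "U ^ i * V ^ j \<subseteq> (U \<union> V) ^ i * (U \<union> V) ^ j"
    by (intro set_times_mono2 mono) auto
  ultimately show "x \<in> (\<Union>k. (U \<union> V) ^ k)"
    by (auto simp flip: power_add)
qed

text \<open>Since \<open>M * M = M\<close>, only the translations accumulate. The exponent starts at
  one because the zeroth power is \<open>{1}\<close> and not \<open>M\<close>.\<close>

lemma set_power_coset:
  fixes M :: "'a::comm_monoid_mult set"
  assumes "submonoid M"
  shows "({a} * M) ^ Suc k = {a ^ Suc k} * M"
proof (induction k)
  case (Suc k)
  have MM: "M * M = M"
    using assms by (force simp: submonoid_def set_times_def)
  have "({a} * M) ^ Suc (Suc k) = {a} * M * ({a ^ Suc k} * M)"
    using Suc by simp
  also have "\<dots> = ({a} * {a ^ Suc k}) * (M * M)"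
    by (simp only: ac_simps)
  finally show ?case
    by (simp only: MM set_times_singleton flip: power_Suc)
qed (simp del: set_one)

text \<open>The star of a single coset is \<open>{1}\<close> together with the translate by
  \<open>a\<close> of the submonoid generated by \<open>a\<close> and \<open>M\<close>.\<close>

lemma coset_union_star:
  assumes "coset_union U"
  shows "coset_union (\<Union>k. U ^ k)"
  using assms
proof induction
  case empty
  have "(\<Union>k. {} ^ k) = {1 :: 'a}"
  proof -
    have "({} :: 'a set) ^ k = (if k = 0 then {1} else {})" for k
      by (cases k) auto
    then show ?thesis by auto
  qed
  then show ?case using coset_union_singleton by simp
next
  case (coset M a)
  have "(\<Union>k. ({a} * M) ^ k) = {1} \<union> (\<Union>k. ({a} * M) ^ Suc k)"
    by (subst UNIV_nat_eq) simp
  also have "(\<Union>k. ({a} * M) ^ Suc k) = (\<Union>k. {a} * ({a ^ k} * M))"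
    by (simp only: set_power_coset[OF coset]) (simp add: mult.assoc flip: set_times_singleton)
  also have "\<dots> = {a} * (range ((^) a) * M)"
    by (simp only: UNION_singleton_eq_range flip: set_times_UNION_distrib)
  finally show ?case
    using coset_union.union[OF coset_union_singleton
        coset_union.coset[OF submonoid_times[OF submonoid_powers coset]]] by simp
next
  case (union U V)
  then show ?case
    by (simp add: set_power_Un coset_union_times)
qed

lemma rational_coset_union:
  assumes "rational (U :: 'a::comm_monoid_mult set)"
  shows "coset_union U"
  using assms
  by induction (auto intro: coset_union_finite coset_union.union coset_union_times coset_union_star)

text \<open>The face \<open>F\<close> restricts attention to elements whose relevant entries are finite.\<close>

lemma rational_bounded:
  fixes U :: "'a::comm_monoid_mult set" and p p' q :: "'a \<Rightarrow> int"
  assumes "rational U"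
    and F: "1 \<in> F" "\<And>x y. x * y \<in> F \<longleftrightarrow> x \<in> F \<and> y \<in> F"
    and add: "\<And>x y. x \<in> F \<Longrightarrow> y \<in> F \<Longrightarrow> p (x * y) = p x + p y"
      "\<And>x y. x \<in> F \<Longrightarrow> y \<in> F \<Longrightarrow> p' (x * y) = p' x + p' y"
      "\<And>x y. x \<in> F \<Longrightarrow> y \<in> F \<Longrightarrow> q (x * y) = q x + q y"
    and bound: "\<And>x. x \<in> U \<Longrightarrow> x \<in> F \<Longrightarrow>
      0 \<le> p x \<and> 0 \<le> p' x \<and> (min (p x) (p' x))\<^sup>2 \<le> 2 * q x"
  obtains C where "\<And>x. x \<in> U \<Longrightarrow> x \<in> F \<Longrightarrow> min (p x) (p' x) \<le> C"
proof -
  have one: "p 1 = 0" "p' 1 = 0" "q 1 = 0"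
    using add[of 1 1] F(1) by auto
  have pow: "t ^ k \<in> F \<and> p (t ^ k) = int k * p t \<and> p' (t ^ k) = int k * p' t \<and> q (t ^ k) = int k * q t"
    if "t \<in> F" for t k
    using that by (induction k) (auto simp: F one add algebra_simps)
  have "coset_union U"
    using assms(1) by (rule rational_coset_union)
  then have "\<exists>C. \<forall>x\<in>U \<inter> F. min (p x) (p' x) \<le> C"
    using bound
  proof induction
    case (coset M a)
    show ?case
    proof (cases "a \<in> F")
      case aF: True
      have bnd: "0 \<le> p a + int k * p t" "0 \<le> p' a + int k * p' t"
        "(min (p a + int k * p t) (p' a + int k * p' t))\<^sup>2 \<le> 2 * (q a + int k * q t)"
        if "t \<in> M" "t \<in> F" for t k
      proof -
        have "a * t ^ k \<in> {a} * M" "a * t ^ k \<in> F"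
          using submonoid_power[OF coset(1) that(1)] pow[OF that(2)] F aF
          by (auto intro: set_times_intro)
        from coset(2)[OF this] show "0 \<le> p a + int k * p t" "0 \<le> p' a + int k * p' t"
          "(min (p a + int k * p t) (p' a + int k * p' t))\<^sup>2 \<le> 2 * (q a + int k * q t)"
          using pow[OF that(2), of k] add[OF aF, of "t ^ k"] by auto
      qed
      \<comment> \<open>A step of at most \<open>-1\<close> would make the term with index
        \<open>\<bar>b\<bar> + 1\<close> negative.\<close>
      have nonneg: "0 \<le> c" if *: "\<And>k. 0 \<le> b + int k * c" for b c :: int
      proof (rule ccontr)
        assume "\<not> 0 \<le> c"
        then have "(\<bar>b\<bar> + 1) * c \<le> (\<bar>b\<bar> + 1) * (- 1)"
          by (intro mult_left_mono) auto
        then show False using *[of "nat (\<bar>b\<bar> + 1)"] by simp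
      qed
      \<comment> \<open>Otherwise some \<open>s\<close> has \<open>p s > 0\<close> and some
        \<open>t\<close> has \<open>p' t > 0\<close>, and both functionals are positive on
        \<open>s * t\<close>.\<close>
      have "(\<forall>t\<in>M \<inter> F. p t = 0) \<or> (\<forall>t\<in>M \<inter> F. p' t = 0)"
      proof (rule ccontr)
        assume "\<not> ?thesis"
        then obtain s t where st: "s \<in> M" "s \<in> F" "t \<in> M" "t \<in> F" "p s \<noteq> 0" "p' t \<noteq> 0"
          by auto
        have "p s \<ge> 0" "p t \<ge> 0" "p' s \<ge> 0" "p' t \<ge> 0"
          using bnd(1,2) nonneg st by metis+
        with st have r: "s * t \<in> M" "s * t \<in> F" "p (s * t) \<ge> 1" "p' (s * t) \<ge> 1"
          using coset(1) by (auto simp: F add submonoid_def)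
        have a0: "p a \<ge> 0" "p' a \<ge> 0"
          using bnd(1,2)[OF r(1,2), of 0] by auto
        \<comment> \<open>Along the powers of \<open>s * t\<close> the squared minimum grows
          quadratically, \<open>q\<close> only linearly. With \<open>k = 4 * A\<close> the bound
          would read \<open>16 * A^2 \<le> 2 * A + 8 * A^2\<close>, impossible for
          \<open>A \<ge> 1\<close>.\<close>
        define A where "A = \<bar>q a\<bar> + \<bar>q (s * t)\<bar> + 1"
        define k where "k = nat (4 * A)"
        have k: "int k = 4 * A" "A \<ge> 1" "q a \<le> A" "q (s * t) \<le> A"
          by (auto simp: A_def k_def)
        have "int k \<le> min (p a + int k * p (s * t)) (p' a + int k * p' (s * t))"
          using a0 mult_left_mono[OF r(3), of "int k"] mult_left_mono[OF r(4), of "int k"] by auto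
        then have "(int k)\<^sup>2 \<le> (min (p a + int k * p (s * t)) (p' a + int k * p' (s * t)))\<^sup>2"
          by (intro power_mono) auto
        also have "\<dots> \<le> 2 * (q a + int k * q (s * t))"
          by (rule bnd(3)[OF r(1,2)])
        also have "\<dots> \<le> 2 * (A + int k * A)"
          by (intro mult_left_mono add_mono k) auto
        finally have "16 * (A * A) \<le> 2 * A + 8 * (A * A)"
          by (simp add: k(1) power2_eq_square)
        moreover have "A \<le> A * A" using k(2) by simp
        ultimately show False using k(2) by linarith
      qed
      \<comment> \<open>The functional that vanishes on the submonoid keeps its value at
        \<open>a\<close> along the coset; \<open>max\<close> covers both cases.\<close>
      then have "\<forall>x\<in>{a} * M \<inter> F. min (p x) (p' x) \<le> max (p a) (p' a)"
        by (auto simp: F add elim!: set_times_elim)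
      then show ?thesis by blast
    qed (auto simp: F elim!: set_times_elim)
  next
    case (union U V)
    have "\<exists>C. \<forall>x\<in>U \<inter> F. min (p x) (p' x) \<le> C" "\<exists>C. \<forall>x\<in>V \<inter> F. min (p x) (p' x) \<le> C"
      by (rule union.IH, rule union.prems, simp_all)+
    then obtain C C' where "\<forall>x\<in>U \<inter> F. min (p x) (p' x) \<le> C" "\<forall>x\<in>V \<inter> F. min (p x) (p' x) \<le> C'"
      by (elim exE)
    then have "\<forall>x\<in>(U \<union> V) \<inter> F. min (p x) (p' x) \<le> max C C'"
      by (auto simp: le_max_iff_disj)
    then show ?case by blast
  qed simp
  then show thesis using that by blast
qed

section \<open>The action of the matrices\<close>

lemma exhaust_6: "x = 1 \<or> x = 2 \<or> x = 3 \<or> x = 4 \<or> x = 5 \<or> x = 6"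
  for x :: 6
proof (induct x)
  case (of_int z)
  then have "z = 0 \<or> z = 1 \<or> z = 2 \<or> z = 3 \<or> z = 4 \<or> z = 5" by fastforce
  then show ?case by auto
qed

lemma UNIV_6: "UNIV = {1, 2, 3, 4, 5, 6 :: 6}"
  using exhaust_6 by auto

lemma sum_6: "sum f (UNIV :: 6 set) = f 1 + f 2 + f 3 + f 4 + f 5 + f 6"
  unfolding UNIV_6 by (simp add: ac_simps)

lemma vector_6 [simp]:
  "(vector [a, b, c, d, e, f] :: 'a::zero^6) $ 1 = a"
  "(vector [a, b, c, d, e, f] :: 'a::zero^6) $ 2 = b"
  "(vector [a, b, c, d, e, f] :: 'a::zero^6) $ 3 = c"
  "(vector [a, b, c, d, e, f] :: 'a::zero^6) $ 4 = d"
  "(vector [a, b, c, d, e, f] :: 'a::zero^6) $ 5 = e"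
  "(vector [a, b, c, d, e, f] :: 'a::zero^6) $ 6 = f"
  unfolding vector_def by auto

lemma vector_4 [simp]:
  "(vector [a, b, c, d] :: 'a::zero^4) $ 1 = a"
  "(vector [a, b, c, d] :: 'a::zero^4) $ 2 = b"
  "(vector [a, b, c, d] :: 'a::zero^4) $ 3 = c"
  "(vector [a, b, c, d] :: 'a::zero^4) $ 4 = d"
  unfolding vector_def by auto

lemma zmin_simps [simp]:
  "Fin 0 * x = x" "x * Fin 0 = x" "x * Infty = Infty" "x + Infty = x"
  by (cases x; auto)+

lemma letter_matrix_mult [simp]:
  "(letter_matrix a\<^sub>1 *v x) $ 1 = x $ 1"
  "(letter_matrix a\<^sub>1 *v x) $ 2 = Fin 1 * x $ 2 + Fin 1 * x $ 3"
  "(letter_matrix a\<^sub>1 *v x) $ 3 = Infty"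
  "(letter_matrix a\<^sub>1 *v x) $ 4 = x $ 4"
  "(letter_matrix a\<^sub>2 *v x) $ 1 = Fin 1 * x $ 1 + Fin 1 * x $ 2"
  "(letter_matrix a\<^sub>2 *v x) $ 2 = x $ 4"
  "(letter_matrix a\<^sub>2 *v x) $ 3 = x $ 4"
  "(letter_matrix a\<^sub>2 *v x) $ 4 = x $ 4"
  "(letter_matrix a\<^sub>1 *v x) $ 5 = Fin (- 1) * x $ 5"
  "(letter_matrix a\<^sub>2 *v x) $ 5 = Fin (- 1) * x $ 5"
  by (simp_all add: matrix_vector_mult_def sum_6 diag_def N\<^sub>1_def N\<^sub>2_def D_def)

lemma \<mu>_mult [simp]:
  "\<mu> [] *v x = x" "\<mu> (a # w) *v x = letter_matrix a *v (\<mu> w *v x)"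
  "\<mu> (v @ w) *v x = \<mu> v *v (\<mu> w *v x)"
  by (simp_all add: \<mu>_append matrix_vector_mul_assoc)

declare \<mu>.simps [simp del] letter_matrix.simps [simp del]

section \<open>Coordinates along a word: length and growth\<close>

lemma \<mu>_mult_4 [simp]: "(\<mu> w *v x) $ 4 = x $ 4"
proof (induction w)
  case (Cons c w)
  then show ?case by (cases c) simp_all
qed simp

lemma \<mu>_mult_5: "(\<mu> w *v x) $ 5 = Fin (- int (length w)) * x $ 5"
proof (induction w)
  case (Cons c w)
  have "Fin (- 1) * (Fin (- int (length w)) * x $ 5) = Fin (- int (length (c # w))) * x $ 5"
    by (cases "x $ 5") auto
  with Cons show ?case by (cases c) simp_all
qed simp

text \<open>Reading the word from right to left, the second coordinate counts the letters
  \<open>a\<^sub>1\<close> since the last \<open>a\<^sub>2\<close>. The next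
  \<open>a\<^sub>2\<close> sets the first coordinate to one more than the minimum of the two and
  restarts the count.\<close>

lemma \<mu>_mult_1_bound:
  assumes x: "x $ 1 = Fin 0" "x $ 2 = Infty" "x $ 3 = Infty" "x $ 4 = Fin 0"
  obtains n where "(\<mu> w *v x) $ 1 = Fin n" "0 \<le> n" "n * (n + 1) \<le> 2 * int (length w)"
proof -
  \<comment> \<open>Here \<open>n\<close> is the first coordinate and \<open>k\<close> the running
    count; \<open>n * (n + 1) + 2 * k\<close> never exceeds twice the length \<open>l\<close>. While
    the second coordinate is infinite no \<open>a\<^sub>2\<close> has occurred, so
    \<open>n = 0\<close>.\<close>
  define good where "good l n y \<longleftrightarrow> y $ 1 = Fin n \<and> 0 \<le> n \<and> n * (n + 1) \<le> 2 * l \<and>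
      (y $ 2 = Infty \<longrightarrow> n = 0) \<and>
      (\<forall>k. y $ 2 = Fin k \<longrightarrow> 0 \<le> k \<and> n * (n + 1) + 2 * k \<le> 2 * l) \<and>
      (\<forall>k. y $ 3 = Fin k \<longrightarrow> 0 \<le> k \<and> n * (n + 1) + 2 * k \<le> 2 * l)"
    for l n :: int and y :: "zmin^6"
  have "\<exists>n. good (int (length w)) n (\<mu> w *v x)"
  proof (induction w)
    case Nil
    then show ?case by (simp add: good_def x)
  next
    case (Cons c w)
    define y where "y = \<mu> w *v x"
    define l where "l = int (length w)"
    from Cons obtain n where n: "good l n y"
      unfolding y_def l_def by blast
    have y4: "y $ 4 = Fin 0"
      by (simp add: y_def x)
    have "\<exists>n. good (l + 1) n (letter_matrix c *v y)"
    proof (cases c)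
      case a\<^sub>1
      have "good (l + 1) n (letter_matrix c *v y)"
        using n unfolding good_def a\<^sub>1 letter_matrix_mult
        by (cases "y $ 2"; cases "y $ 3") (simp_all add: min_def)
      then show ?thesis by blast
    next
      case a\<^sub>2
      show ?thesis
      proof (cases "y $ 2")
        case Infty
        then have "good (l + 1) 1 (letter_matrix c *v y)"
          using n y4 by (auto simp: good_def a\<^sub>2)
        then show ?thesis by blast
      next
        case (Fin k)
        \<comment> \<open>The new first coordinate is \<open>m + 1\<close>, and
          \<open>(m + 1) * (m + 2) = m * (m + 1) + 2 * (m + 1)\<close> is at most
          \<open>n * (n + 1) + 2 * k + 2\<close>.\<close>
        define m where "m = min n k"
        have m: "0 \<le> m" "m \<le> n" "m \<le> k" and k: "n * (n + 1) + 2 * k \<le> 2 * l"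
          using n Fin by (auto simp: m_def good_def)
        have "m * (m + 1) \<le> n * (n + 1)"
          using m by (intro mult_mono) auto
        then have "(m + 1) * (m + 1 + 1) \<le> 2 * (l + 1)"
          using m(3) k by (simp add: algebra_simps)
        moreover have "(letter_matrix c *v y) $ 1 = Fin (m + 1)"
          using n Fin by (simp add: good_def a\<^sub>2 m_def)
        ultimately have "good (l + 1) (m + 1) (letter_matrix c *v y)"
          using m(1) y4 unfolding good_def by (simp add: a\<^sub>2)
        then show ?thesis by blast
      qed
    qed
    then show ?case
      by (simp add: y_def l_def add.commute)
  qed
  then show thesis using that unfolding good_def by blast
qed

text \<open>The third coordinate is infinite after one letter. The hypothesis, which holds right
  after an \<open>a\<^sub>2\<close>, makes the minimum in the first step the same as in the later
  ones.\<close>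

lemma \<mu>_mult_replicate:
  assumes "x $ 3 = x $ 2"
  shows "(\<mu> (replicate n a\<^sub>1) *v x) $ 1 = x $ 1"
    "(\<mu> (replicate n a\<^sub>1) *v x) $ 2 = Fin (int n) * x $ 2"
proof (induction n)
  case (Suc n)
  {
    case 1
    show ?case using Suc by simp
  next
    case 2
    have "(\<mu> (replicate n a\<^sub>1) *v x) $ 3 = (if n = 0 then x $ 2 else Infty)"
      using assms by (cases n) auto
    then show ?case
      using Suc by (cases "x $ 2") auto
  }
qed simp_all

lemma matrix_mult_axis: "(A *v axis j 1) $ i = (A $ i $ j :: 'a::semiring_1)"
  by (simp add: matrix_vector_mult_def axis_def if_distrib cong: if_cong)

text \<open>Blocks of \<open>a\<^sub>1\<close> as long as the current value let each further
  \<open>a\<^sub>2\<close> raise it. One word serves \<open>axis 1 1\<close>,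
  \<open>axis 4 1\<close> and \<open>B\<close> at once; the last two account for the two values of
  \<open>x $ 1\<close>.\<close>

lemma \<mu>_mult_1_unbounded:
  obtains w where
    "(\<mu> w *v axis 1 1) $ 1 = Fin (int n + 2)"
    "\<And>x. x $ 1 \<in> {Fin 0, Infty} \<Longrightarrow> x $ 2 = Infty \<Longrightarrow> x $ 3 = Infty \<Longrightarrow> x $ 4 = Fin 0 \<Longrightarrow>
      (\<mu> w *v x) $ 1 = Fin (int n + 2)"
proof -
  have "\<exists>w. (\<mu> w *v axis 1 1) $ 1 = Fin (int n + 2) \<and> (\<mu> w *v axis 1 1) $ 2 = Infty \<and>
    (\<mu> w *v axis 1 1) $ 3 = Infty \<and>
    (\<forall>x. x $ 1 \<in> {Fin 0, Infty} \<and> x $ 2 = Infty \<and> x $ 3 = Infty \<and> x $ 4 = Fin 0 \<longrightarrow>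
      (\<mu> w *v x) $ 1 = Fin (int n + 2) \<and> (\<mu> w *v x) $ 2 = Fin 0 \<and> (\<mu> w *v x) $ 3 = Fin 0)"
  proof (induction n)
    case 0
    \<comment> \<open>After one \<open>a\<^sub>2\<close> the first coordinate is still 1 or
      infinite, depending on \<open>x $ 1\<close>; the second \<open>a\<^sub>2\<close> makes it 2 in
      both cases, hence the offset.\<close>
    show ?case
      by (rule exI[of _ "[a\<^sub>2, a\<^sub>1, a\<^sub>2]"]) (auto simp: axis_def zero_zmin_def one_zmin_def)
  next
    case (Suc n)
    then obtain w where w: "(\<mu> w *v axis 1 1) $ 1 = Fin (int n + 2)"
      "(\<mu> w *v axis 1 1) $ 2 = Infty" "(\<mu> w *v axis 1 1) $ 3 = Infty"
      "\<And>x. x $ 1 \<in> {Fin 0, Infty} \<Longrightarrow> x $ 2 = Infty \<Longrightarrow> x $ 3 = Infty \<Longrightarrow> x $ 4 = Fin 0 \<Longrightarrow>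
      (\<mu> w *v x) $ 1 = Fin (int n + 2) \<and> (\<mu> w *v x) $ 2 = Fin 0 \<and> (\<mu> w *v x) $ 3 = Fin 0"
      by blast
    \<comment> \<open>With this block length the second coordinate, 0 after \<open>w\<close>,
      catches up with the first before the next \<open>a\<^sub>2\<close>. For
      \<open>axis 1 1\<close> it stays infinite.\<close>
    obtain m where m: "m = n + 2" by simp
    define v where "v = a\<^sub>2 # replicate m a\<^sub>1 @ w"
    have e: "(\<mu> w *v axis 1 1) $ 4 = Infty"
      by (simp add: axis_def zero_zmin_def)
    have "(\<mu> v *v axis 1 1) $ 1 = Fin (int (Suc n) + 2)" "(\<mu> v *v axis 1 1) $ 2 = Infty"
      "(\<mu> v *v axis 1 1) $ 3 = Infty"
      using w(1-3) e by (simp_all add: v_def \<mu>_mult_replicate)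
    moreover have "(\<mu> v *v x) $ 1 = Fin (int (Suc n) + 2) \<and> (\<mu> v *v x) $ 2 = Fin 0 \<and> (\<mu> v *v x) $ 3 = Fin 0"
      if "x $ 1 \<in> {Fin 0, Infty} \<and> x $ 2 = Infty \<and> x $ 3 = Infty \<and> x $ 4 = Fin 0" for x
      using w(4)[of x] that by (simp add: v_def \<mu>_mult_replicate) (simp add: m)
    ultimately show ?case
      by blast
  qed
  then show thesis using that by blast
qed

section \<open>Spans and non-rationality\<close>

lemma sum_zmin_eq_Infty:
  assumes "finite I" "(\<Sum>i\<in>I. f i) = Infty" "i \<in> I"
  shows "f i = Infty"
  using assms
proof (induction)
  case (insert j I)
  then show ?case
    by (cases "f j"; cases "sum f I") auto
qed simp

lemma sum_zmin_eq_Fin: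
  assumes "finite I" "(\<Sum>i\<in>I. f i) = Fin a"
  shows "(\<exists>i\<in>I. f i = Fin a) \<and> (\<forall>i\<in>I. \<forall>b. f i = Fin b \<longrightarrow> a \<le> b)"
  using assms
proof (induction arbitrary: a)
  case empty
  then show ?case by (simp add: zero_zmin_def)
next
  case (insert j I)
  show ?case
  proof (cases "sum f I")
    case (Fin s)
    note IH = insert.IH[OF Fin]
    show ?thesis
    proof (cases "f j")
      case j: (Fin t)
      have a: "a = min t s"
        using insert.prems insert.hyps Fin j by simp
      show ?thesis
      proof (intro conjI ballI allI impI)
        show "\<exists>i\<in>insert j I. f i = Fin a"
          using IH j a by (cases "t \<le> s") (auto simp: min_def)
      next
        fix i b assume "i \<in> insert j I" "f i = Fin b"
        then consider "b = t" | "s \<le> b"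
          using IH j by auto
        then show "a \<le> b"
          using a by cases auto
      qed
    next
      case Infty
      then show ?thesis
        using IH insert.prems insert.hyps Fin by simp
    qed
  next
    case Infty
    have "\<forall>i\<in>I. f i = Infty"
      using sum_zmin_eq_Infty[OF insert.hyps(1) Infty] by simp
    then show ?thesis
      using Infty insert.prems insert.hyps by auto
  qed
qed

lemma zmin_times_eq_Fin: "x * y = Fin c \<longleftrightarrow> (\<exists>a b. x = Fin a \<and> y = Fin b \<and> c = a + b)"
  by (cases x; cases y) auto

text \<open>The value at \<open>Infty\<close> is a dummy; additivity is claimed only for finite
  entries, which the faces \<open>F\<close> below guarantee.\<close>

definition zval :: "zmin \<Rightarrow> int" where
  "zval x = (case x of Fin a \<Rightarrow> a | Infty \<Rightarrow> 0)"

lemma zval_Fin [simp]: "zval (Fin a) = a"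
  by (simp add: zval_def)

lemma zval_times: "x \<noteq> Infty \<Longrightarrow> y \<noteq> Infty \<Longrightarrow> zval (x * y) = zval x + zval y"
  by (cases x; cases y) auto

lemma zmin_times_eq_Infty: "x * y = Infty \<longleftrightarrow> x = Infty \<or> y = Infty" for x y :: zmin
  by (cases x; cases y) auto

lemma semimodule_span_superset: "G \<subseteq> semimodule_span G"
proof
  fix g assume "g \<in> G"
  then show "g \<in> semimodule_span G"
    unfolding semimodule_span_def
    by (intro CollectI exI[of _ 1] exI[of _ "\<lambda>_. 1"] exI[of _ "\<lambda>_. g"]) simp
qed

text \<open>Each \<open>\<mu> w *v B\<close> has fourth coordinate 0, so \<open>c\<close> is the
  least coefficient of the combination. A summand with that coefficient bounds coordinates 1 and 5
  from above simultaneously.\<close>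

lemma reachable_space_bound:
  assumes "g \<in> reachable_space" "g $ 4 = Fin c"
  obtains a b where "g $ 1 = Fin a" "g $ 5 = Fin b" "c \<le> a" "(a - c)\<^sup>2 \<le> 2 * (c - b)"
proof -
  obtain k l u where g: "g = (\<Sum>i<k. l i *s u i)" and u: "\<forall>i<k::nat. u i \<in> {\<mu> w *v B | w. True}"
    using assms(1) by (auto simp: reachable_space_def semimodule_span_def)
  have g_nth: "g $ j = (\<Sum>i<k. l i * u i $ j)" for j
    by (simp add: g)
  have B: "B $ 1 = Fin 0" "B $ 2 = Infty" "B $ 3 = Infty" "B $ 4 = Fin 0" "B $ 5 = Fin 0"
    by (simp_all add: B_def)
  have "\<exists>n m. u i $ 1 = Fin n \<and> u i $ 5 = Fin (- m) \<and> u i $ 4 = Fin 0 \<and>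
      0 \<le> n \<and> n * (n + 1) \<le> 2 * m" if "i < k" for i
  proof -
    from u that obtain w where w: "u i = \<mu> w *v B" by blast
    obtain n where "u i $ 1 = Fin n" "0 \<le> n" "n * (n + 1) \<le> 2 * int (length w)"
      using \<mu>_mult_1_bound[of B w] B w by metis
    moreover have "u i $ 5 = Fin (- int (length w))" "u i $ 4 = Fin 0"
      using B by (simp_all add: w \<mu>_mult_5)
    ultimately show ?thesis by blast
  qed
  then obtain n m where nm: "\<And>i. i < k \<Longrightarrow> u i $ 1 = Fin (n i)" "\<And>i. i < k \<Longrightarrow> u i $ 5 = Fin (- m i)"
     "\<And>i. i < k \<Longrightarrow> u i $ 4 = Fin 0" "\<And>i. i < k \<Longrightarrow> 0 \<le> n i"
     "\<And>i. i < k \<Longrightarrow> n i * (n i + 1) \<le> 2 * m i"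
    by metis
  have sum4: "(\<exists>i<k. l i * u i $ 4 = Fin c) \<and> (\<forall>i<k. \<forall>b. l i * u i $ 4 = Fin b \<longrightarrow> c \<le> b)"
    using sum_zmin_eq_Fin[of "{..<k}" "\<lambda>i. l i * u i $ 4" c] assms(2) g_nth[of 4] by auto
  then obtain i where i: "i < k" "l i = Fin c"
    using nm(3) by auto
  have *: "\<exists>a. g $ j = Fin a \<and> (\<exists>i<k. l i * u i $ j = Fin a) \<and> (\<forall>i<k. \<forall>b. l i * u i $ j = Fin b \<longrightarrow> a \<le> b)"
    if "u i $ j \<noteq> Infty" for j
  proof -
    have "g $ j \<noteq> Infty"
      using sum_zmin_eq_Infty[of "{..<k}" "\<lambda>i. l i * u i $ j" i] that i
      by (auto simp: g_nth zmin_times_eq_Infty)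
    then obtain a where "g $ j = Fin a" by (cases "g $ j") auto
    then show ?thesis
      using sum_zmin_eq_Fin[of "{..<k}" "\<lambda>i. l i * u i $ j" a] g_nth[of j] by auto
  qed
  obtain a where a: "g $ 1 = Fin a" "\<exists>i<k. l i * u i $ 1 = Fin a" "\<forall>i<k. \<forall>b. l i * u i $ 1 = Fin b \<longrightarrow> a \<le> b"
    using *[of 1] nm(1) i(1) by auto
  obtain b where b: "g $ 5 = Fin b" "\<forall>i<k. \<forall>d. l i * u i $ 5 = Fin d \<longrightarrow> b \<le> d"
    using *[of 5] nm(2) i(1) by auto
  \<comment> \<open>The first coordinate may be attained at another index \<open>j\<close>; there
    \<open>c \<le> d\<close> and \<open>0 \<le> n j\<close> give \<open>c \<le> a\<close>.\<close>
  obtain j where j: "j < k" "l j * u j $ 1 = Fin a"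
    using a(2) by blast
  then obtain d where d: "l j = Fin d" "a = d + n j"
    using nm(1)[OF j(1)] by (auto simp: zmin_times_eq_Fin)
  have "c \<le> d"
    using sum4 j(1) d(1) nm(3)[OF j(1)] by auto
  then have "c \<le> a"
    using d(2) nm(4)[OF j(1)] by simp
  have "a \<le> c + n i" "b \<le> c - m i"
    using a(3) b(2) i nm(1,2)[OF i(1)] by auto
  then have "(a - c)\<^sup>2 \<le> (n i)\<^sup>2" and m: "m i \<le> c - b"
    using \<open>c \<le> a\<close> by (auto intro: power_mono)
  note this(1)
  also have "(n i)\<^sup>2 \<le> 2 * m i"
    using nm(4,5)[OF i(1)] by (simp add: power2_eq_square algebra_simps)
  also have "\<dots> \<le> 2 * (c - b)"
    using m by simp
  finally have "(a - c)\<^sup>2 \<le> 2 * (c - b)" .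
  with a(1) b(1) \<open>c \<le> a\<close> show thesis by (rule that)
qed

text \<open>Rationality bounds the difference of coordinates 1 and 4 on \<open>G\<close>. In a
  combination with a larger difference, some generator has a difference at least as large.\<close>

lemma not_rational_reachable_space: "\<not> rational_subsemimodule reachable_space"
proof
  assume "rational_subsemimodule reachable_space"
  then obtain G where G: "rational G" "reachable_space = semimodule_span G"
    by (auto simp: rational_subsemimodule_def)
  define F where "F = {g :: zmin^6. g $ 1 \<noteq> Infty \<and> g $ 4 \<noteq> Infty \<and> g $ 5 \<noteq> Infty}"
  define p where "p = (\<lambda>g :: zmin^6. zval (g $ 1) - zval (g $ 4))"
  define q where "q = (\<lambda>g :: zmin^6. zval (g $ 4) - zval (g $ 5))"
  have bound: "0 \<le> p g \<and> 0 \<le> p g \<and> (min (p g) (p g))\<^sup>2 \<le> 2 * q g" if g: "g \<in> G" "g \<in> F" for g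
  proof -
    have "g \<in> reachable_space"
      using g(1) semimodule_span_superset by (auto simp: G(2))
    moreover obtain c where "g $ 4 = Fin c"
      using g(2) by (cases "g $ 4") (auto simp: F_def)
    ultimately show ?thesis
      by (elim reachable_space_bound) (auto simp: p_def q_def)
  qed
  \<comment> \<open>One functional is enough here: with \<open>p' = p\<close> the minimum is
    \<open>p\<close> itself.\<close>
  obtain C where C: "\<And>g. g \<in> G \<Longrightarrow> g \<in> F \<Longrightarrow> p g \<le> C"
    by (rule rational_bounded[OF G(1), where F = F and p = p and p' = p and q = q])
      (use bound in \<open>auto simp: F_def p_def q_def zval_times zmin_times_eq_Infty one_zmin_def\<close>)
  obtain w where w: "(\<mu> w *v B) $ 1 = Fin (int (nat C) + 2)"
  proof (rule \<mu>_mult_1_unbounded[of "nat C"])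
    fix w assume *: "\<And>x. x $ 1 \<in> {Fin 0, Infty} \<Longrightarrow> x $ 2 = Infty \<Longrightarrow> x $ 3 = Infty \<Longrightarrow>
      x $ 4 = Fin 0 \<Longrightarrow> (\<mu> w *v x) $ 1 = Fin (int (nat C) + 2)"
    show thesis
      by (rule that[of w], rule *) (simp_all add: B_def)
  qed
  have "\<mu> w *v B \<in> semimodule_span G"
    unfolding G(2)[symmetric] reachable_space_def
    by (rule subsetD[OF semimodule_span_superset]) blast
  then obtain k l u where g: "\<mu> w *v B = (\<Sum>i<k. l i *s u i)" and u: "\<forall>i<k::nat. u i \<in> G"
    by (auto simp: semimodule_span_def)
  have g_nth: "(\<Sum>i<k. l i * u i $ j) = (\<mu> w *v B) $ j" for j
    by (simp add: g)
  have "(\<Sum>i<k. l i * u i $ 4) = Fin 0"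
    by (simp add: g_nth) (simp add: B_def)
  \<comment> \<open>A summand attaining the fourth coordinate 0 has coefficient \<open>-c\<close>,
    and its first coordinate \<open>a - c\<close> cannot lie below that of the sum.\<close>
  from sum_zmin_eq_Fin[OF _ this] obtain i where i: "i < k" "l i * u i $ 4 = Fin 0"
    by auto
  then obtain c where c: "l i = Fin (- c)" "u i $ 4 = Fin c"
    by (auto simp: zmin_times_eq_Fin eq_neg_iff_add_eq_0)
  have iG: "u i \<in> G" using u i(1) by blast
  then have "u i \<in> reachable_space"
    using semimodule_span_superset by (auto simp: G(2))
  from this c(2) obtain a b where ab: "u i $ 1 = Fin a" "u i $ 5 = Fin b"
    by (rule reachable_space_bound)
  have "int (nat C) + 2 \<le> a - c"
    using sum_zmin_eq_Fin[OF _ trans[OF g_nth w]] i(1) c(1) ab(1) by auto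
  moreover have "a - c \<le> C"
    using C[OF iG] ab c by (simp add: F_def p_def)
  ultimately show False by linarith
qed

text \<open>The quadratic bound concerns a minimum of two entries, which is not additive under
  entrywise addition. The two entries are additive separately, hence the pair \<open>p\<close>,
  \<open>p'\<close>.\<close>

lemma not_rational_range_\<mu>: "\<not> rational (range \<mu>)"
proof
  assume rat: "rational (range \<mu>)"
  define F where "F = {A :: zmin^6^6. A $ 1 $ 1 \<noteq> Infty \<and> A $ 1 $ 4 \<noteq> Infty \<and> A $ 5 $ 5 \<noteq> Infty}"
  define p where "p = (\<lambda>A :: zmin^6^6. zval (A $ 1 $ 1))"
  define p' where "p' = (\<lambda>A :: zmin^6^6. zval (A $ 1 $ 4))"
  define q where "q = (\<lambda>A :: zmin^6^6. - zval (A $ 5 $ 5))"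
  have bound: "0 \<le> p A \<and> 0 \<le> p' A \<and> (min (p A) (p' A))\<^sup>2 \<le> 2 * q A" if A: "A \<in> range \<mu>" "A \<in> F" for A
  proof -
    obtain w where w: "A = \<mu> w" using A(1) by (rule rangeE)
    obtain a b where ab: "A $ 1 $ 1 = Fin a" "A $ 1 $ 4 = Fin b"
      using A(2) by (cases "A $ 1 $ 1"; cases "A $ 1 $ 4") (auto simp: F_def)
    have A55: "A $ 5 $ 5 = Fin (- int (length w))"
      using \<mu>_mult_5[of w "axis 5 1"] by (simp add: w matrix_mult_axis)
    \<comment> \<open>The entrywise minimum of two unit vectors: the first coordinate of its image
      is the minimum of the entries (1,1) and (1,4).\<close>
    define x :: "zmin^6" where "x = axis 1 1 + axis 4 1"
    have "x $ 1 = Fin 0" "x $ 2 = Infty" "x $ 3 = Infty" "x $ 4 = Fin 0"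
      by (simp_all add: x_def axis_def one_zmin_def zero_zmin_def)
    then obtain n where n: "(\<mu> w *v x) $ 1 = Fin n" "0 \<le> n" "n * (n + 1) \<le> 2 * int (length w)"
      by (rule \<mu>_mult_1_bound)
    have "n = min a b"
      using n(1) ab by (simp add: x_def matrix_vector_right_distrib matrix_mult_axis w)
    moreover have "n\<^sup>2 \<le> 2 * int (length w)"
      using n(2,3) by (simp add: power2_eq_square algebra_simps)
    ultimately show ?thesis
      using n(2) ab A55 by (simp add: p_def p'_def q_def)
  qed
  obtain C where C: "\<And>A. A \<in> range \<mu> \<Longrightarrow> A \<in> F \<Longrightarrow> min (p A) (p' A) \<le> C"
    by (rule rational_bounded[OF rat, where F = F and p = p and p' = p' and q = q])
      (use bound in \<open>auto simp: F_def p_def p'_def q_def zval_times zmin_times_eq_Infty one_zmin_def\<close>)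
  obtain w where w: "(\<mu> w *v axis 1 1) $ 1 = Fin (int (nat C) + 2)"
    "(\<mu> w *v axis 4 1) $ 1 = Fin (int (nat C) + 2)"
  proof (rule \<mu>_mult_1_unbounded[of "nat C"])
    fix w assume *: "(\<mu> w *v axis 1 1) $ 1 = Fin (int (nat C) + 2)"
      "\<And>x. x $ 1 \<in> {Fin 0, Infty} \<Longrightarrow> x $ 2 = Infty \<Longrightarrow> x $ 3 = Infty \<Longrightarrow> x $ 4 = Fin 0 \<Longrightarrow>
        (\<mu> w *v x) $ 1 = Fin (int (nat C) + 2)"
    show thesis
      by (rule that[OF *(1)], rule *(2)) (simp_all add: axis_def one_zmin_def zero_zmin_def)
  qed
  have "\<mu> w $ 5 $ 5 = Fin (- int (length w))"
    using \<mu>_mult_5[of w "axis 5 1"] by (simp add: matrix_mult_axis)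
  then have "\<mu> w \<in> F" "min (p (\<mu> w)) (p' (\<mu> w)) = int (nat C) + 2"
    using w by (simp_all add: matrix_mult_axis F_def p_def p'_def)
  with C[of "\<mu> w"] show False by (auto split: if_splits)
qed

theorem proposition4p4:
  shows "\<not> rational_subsemimodule reachable_space \<and> \<not> rational (range \<mu>)"
  using not_rational_reachable_space not_rational_range_\<mu> by blast

end
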